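(* Let $f,g:\mathbb{F}_2^n\to\{-1,1\}$, let $t=\min\{\|f\|_{1,1/3},\|g\|_{1,1/3}\}$, and let $\epsilon,\omega>0$. Consider the two-party communication problem in which Alice is given $f$, Bob is given $g$, and it is promised that either $\delta_{\mathcal{L}}(f,g)\le\epsilon$ or $\delta_{\mathcal{L}}(f,g)\ge\epsilon+\omega$; the players must decide which of the two cases holds. The two-party communication complexity of this problem is $O\left(t^{4}\log^{2}(1/\omega)\right)$.
   Context: Communication is in Yao's deterministic two-party model: the players exchange bits according to a protocol, and the cost is the number of bits exchanged in the worst case. For $S\in\mathbb{F}_2^n$, $\chi_S(x)=(-1)^{\langle S,x\rangle}$, and every $p:\mathbb{F}_2^n\to\mathbb{R}$ has a unique expansion $p=\sum_{S}\widehat p(S)\chi_S$. The spectral norm is $\|p\|_1=\sum_S|\widehat p(S)|$. A function $p:\mathbb{F}_2^n\to\mathbb{R}$ $\alpha$-approximates $f$ if $|f(x)-p(x)|\le\alpha$ for all $x$, and $\|f\|_{1,\alpha}=\inf\{\|p\|_1: p\ \alpha\text{-approximates } f\}$. The fractional Hamming distance is $\delta(f,g)=\Pr_{x}[f(x)\neq g(x)]$ for uniform $x\in\mathbb{F}_2^n$. For $M\in GL_n(\mathbb{F}_2)$, $(f\circ M)(x)=f(Mx)$. The linear isomorphism distance is $\delta_{\mathcal{L}}(f,g)=\min_{M\in GL_n(\mathbb{F}_2)}\delta(f\circ M,g)$.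
   Formalization: The factor log(1/ω) is read as max(1, log(1/ω)), which changes the bound only for ω > 1/2; as displayed it fails as ω tends to 1 (f=1 against g=1 or g=-1 with ε=1-ω needs at least one bit). *)

theory Defs
  imports
    Complex_Main
    "HOL-Library.FuncSet"
    "HOL-Library.Z2"
    "Jordan_Normal_Form.Matrix"
begin

section \<open>Fourier expansion over the two-element field\<close>

abbreviation F2 :: "nat \<Rightarrow> bit vec set" where
  "F2 n \<equiv> carrier_vec n"

definition chi :: "bit vec \<Rightarrow> bit vec \<Rightarrow> real" where
  "chi S x = (-1) ^ of_bit (S \<bullet> x)"

text \<open>Only the values of a function on \<open>F2 n\<close> matter here; the coefficient function is made
  extensional so that it is unique. Existence and uniqueness are \<open>ex1_fourier_expansion\<close>
  below.\<close>

definition fourier :: "nat \<Rightarrow> (bit vec \<Rightarrow> real) \<Rightarrow> bit vec \<Rightarrow> real" where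
  "fourier n p = (THE c. c \<in> extensional (F2 n) \<and>
     (\<forall>x\<in>F2 n. p x = (\<Sum>S\<in>F2 n. c S * chi S x)))"

definition spectral_norm :: "nat \<Rightarrow> (bit vec \<Rightarrow> real) \<Rightarrow> real" where
  "spectral_norm n p = (\<Sum>S\<in>F2 n. \<bar>fourier n p S\<bar>)"

definition approximates :: "nat \<Rightarrow> real \<Rightarrow> (bit vec \<Rightarrow> real) \<Rightarrow> (bit vec \<Rightarrow> real) \<Rightarrow> bool" where
  "approximates n \<alpha> p f \<longleftrightarrow> (\<forall>x\<in>F2 n. \<bar>f x - p x\<bar> \<le> \<alpha>)"

definition approx_spectral_norm :: "nat \<Rightarrow> real \<Rightarrow> (bit vec \<Rightarrow> real) \<Rightarrow> real" where
  "approx_spectral_norm n \<alpha> f = Inf {spectral_norm n p | p. approximates n \<alpha> p f}"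


section \<open>Linear isomorphism distance\<close>

definition boolean_functions :: "nat \<Rightarrow> (bit vec \<Rightarrow> real) set" where
  "boolean_functions n = (F2 n \<rightarrow>\<^sub>E {-1, 1})"

definition hamming_distance :: "nat \<Rightarrow> (bit vec \<Rightarrow> real) \<Rightarrow> (bit vec \<Rightarrow> real) \<Rightarrow> real" where
  "hamming_distance n f g = real (card {x \<in> F2 n. f x \<noteq> g x}) / real (card (F2 n))"

definition GL :: "nat \<Rightarrow> bit mat set" where
  "GL n = {M \<in> carrier_mat n n. invertible_mat M}"

definition linear_iso_distance :: "nat \<Rightarrow> (bit vec \<Rightarrow> real) \<Rightarrow> (bit vec \<Rightarrow> real) \<Rightarrow> real" where
  "linear_iso_distance n f g = (MIN M\<in>GL n. hamming_distance n (\<lambda>x. f (M *\<^sub>v x)) g)"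


section \<open>Deterministic two-party protocols\<close>

text \<open>A protocol tree: at an inner node the named player sends one bit, computed from that
  player's own input; the subtree taken on bit \<^const>\<open>True\<close> is the first one. The answer is
  determined by the transcript, so both players know it.\<close>

datatype ('x, 'y) protocol =
    Output bool
  | Alice "'x \<Rightarrow> bool" "('x, 'y) protocol" "('x, 'y) protocol"
  | Bob "'y \<Rightarrow> bool" "('x, 'y) protocol" "('x, 'y) protocol"

primrec answer :: "('x, 'y) protocol \<Rightarrow> 'x \<Rightarrow> 'y \<Rightarrow> bool" where
  "answer (Output b) x y = b"
| "answer (Alice a P Q) x y = (if a x then answer P x y else answer Q x y)"
| "answer (Bob b P Q) x y = (if b y then answer P x y else answer Q x y)"

primrec bits_exchanged :: "('x, 'y) protocol \<Rightarrow> 'x \<Rightarrow> 'y \<Rightarrow> nat" where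
  "bits_exchanged (Output b) x y = 0"
| "bits_exchanged (Alice a P Q) x y =
     Suc (if a x then bits_exchanged P x y else bits_exchanged Q x y)"
| "bits_exchanged (Bob b P Q) x y =
     Suc (if b y then bits_exchanged P x y else bits_exchanged Q x y)"

definition solves_promise ::
  "('x, 'y) protocol \<Rightarrow> 'x set \<Rightarrow> 'y set \<Rightarrow> ('x \<Rightarrow> 'y \<Rightarrow> bool) \<Rightarrow> ('x \<Rightarrow> 'y \<Rightarrow> bool) \<Rightarrow> bool" where
  "solves_promise P X Y yes no \<longleftrightarrow>
     (\<forall>x\<in>X. \<forall>y\<in>Y. (yes x y \<longrightarrow> answer P x y) \<and> (no x y \<longrightarrow> \<not> answer P x y))"

text \<open>The bound may depend on the inputs, as required when the complexity is measured by a
  parameter \<open>t x y\<close> of the input pair: one protocol, not told the value of \<open>t x y\<close>, has to meet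
  the bound. For a constant bound this says that the worst-case cost is at most that constant.
  The bound is imposed on all input pairs, also those violating the promise.\<close>

definition comm_complexity_le ::
  "'x set \<Rightarrow> 'y set \<Rightarrow> ('x \<Rightarrow> 'y \<Rightarrow> bool) \<Rightarrow> ('x \<Rightarrow> 'y \<Rightarrow> bool) \<Rightarrow> ('x \<Rightarrow> 'y \<Rightarrow> real) \<Rightarrow> bool" where
  "comm_complexity_le X Y yes no bound \<longleftrightarrow>
     (\<exists>P. solves_promise P X Y yes no \<and>
          (\<forall>x\<in>X. \<forall>y\<in>Y. real (bits_exchanged P x y) \<le> bound x y))"


section \<open>Well-definedness\<close>

lemma bit_vecs_Suc: "F2 (Suc n) = (\<lambda>(a, v). vCons a v) ` ({0, 1} \<times> F2 n)"
proof (intro equalityI subsetI)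
  fix v :: "bit vec" assume v: "v \<in> F2 (Suc n)"
  then obtain a w where w: "v = vCons a w" "w \<in> F2 n"
    by (metis carrier_vecD carrier_vec_dim_vec dim_vec_vCons nat.inject vec_cases dim_vec nat.distinct(1))
  have "a \<in> {0, 1}" by (cases a) auto
  with w show "v \<in> (\<lambda>(a, v). vCons a v) ` ({0, 1} \<times> F2 n)" by force
qed auto

lemma finite_card_F2: "finite (F2 n) \<and> card (F2 n) = 2 ^ n"
proof (induction n)
  case 0
  have "F2 0 = {vNil}" by auto
  then show ?case by simp
next
  case (Suc n)
  have "inj_on (\<lambda>(a :: bit, v). vCons a v) ({0, 1} \<times> F2 n)"
    by (auto simp: inj_on_def)
  then show ?case
    using Suc by (simp add: bit_vecs_Suc card_image card_cartesian_product)
qed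

lemma finite_F2 [simp]: "finite (F2 n)"
  and card_F2 [simp]: "card (F2 n) = 2 ^ n"
  using finite_card_F2 by auto

lemma sgn_bit_add: "(-1 :: real) ^ of_bit (a + b) = (-1) ^ of_bit a * (-1) ^ of_bit b"
  by (cases a; cases b) auto

lemma sum_char_zero:
  assumes S: "S \<in> F2 n" and T: "T \<in> F2 n" and ne: "S \<noteq> T"
  shows "(\<Sum>x\<in>F2 n. chi S x * chi T x) = 0"
proof -
  obtain i where i: "i < n" "S $ i \<noteq> T $ i"
    using S T ne by (metis carrier_vecD eq_vecI)
  let ?u = "unit_vec n i :: bit vec"
  have u: "?u \<in> F2 n" by simp
  have uu: "x + ?u + ?u = x" if "x \<in> F2 n" for x
  proof (rule eq_vecI)
    fix j assume "j < dim_vec x"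
    with that show "(x + ?u + ?u) $ j = x $ j"
      by (simp add: add.assoc del: add_bit_eq_xor)
  qed (use that in simp)
  have bij: "bij_betw (\<lambda>x. x + ?u) (F2 n) (F2 n)"
    by (rule bij_betw_byWitness[where f' = "\<lambda>x. x + ?u"]) (auto simp: uu)
  have shift: "chi R (x + ?u) = chi R x * (-1) ^ of_bit (R $ i)"
    if "R \<in> F2 n" "x \<in> F2 n" for R x
    using that i(1) by (simp only: chi_def scalar_prod_add_distrib[OF that u] sgn_bit_add
        scalar_prod_right_unit[OF i(1)] scalar_prod_right_unit)
  have sg: "(-1 :: real) ^ of_bit (S $ i) * (-1) ^ of_bit (T $ i) = -1"
    using i(2) by (cases "S $ i"; cases "T $ i") auto
  have "(\<Sum>x\<in>F2 n. chi S x * chi T x) = (\<Sum>x\<in>F2 n. chi S (x + ?u) * chi T (x + ?u))"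
    using sum.reindex_bij_betw[OF bij, of "\<lambda>x. chi S x * chi T x"] by simp
  also have "\<dots> = (\<Sum>x\<in>F2 n. (chi S x * chi T x) * ((-1) ^ of_bit (S $ i) * (-1) ^ of_bit (T $ i)))"
    by (intro sum.cong refl) (simp only: shift[OF S] shift[OF T] mult.assoc mult.left_commute mult.commute)
  also have "\<dots> = - (\<Sum>x\<in>F2 n. chi S x * chi T x)"
    by (simp only: sg) (simp add: sum_negf)
  finally show ?thesis by simp
qed

lemma chi_commute: "S \<in> F2 n \<Longrightarrow> x \<in> F2 n \<Longrightarrow> chi S x = chi x S"
  unfolding chi_def using comm_scalar_prod by metis

lemma chi_square: "chi S x * chi S x = 1"
  unfolding chi_def by (cases "S \<bullet> x") auto

lemma sum_chi_chi:
  assumes "S \<in> F2 n" "T \<in> F2 n"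
  shows "(\<Sum>x\<in>F2 n. chi S x * chi T x) = (if S = T then 2 ^ n else 0)"
  using sum_char_zero[OF assms] by (simp add: chi_square)

lemma expansion_unique:
  assumes c: "\<forall>x\<in>F2 n. p x = (\<Sum>S\<in>F2 n. c S * chi S x)" and T: "T \<in> F2 n"
  shows "c T = (\<Sum>x\<in>F2 n. p x * chi T x) / 2 ^ n"
proof -
  have "(\<Sum>x\<in>F2 n. p x * chi T x) = (\<Sum>x\<in>F2 n. \<Sum>S\<in>F2 n. c S * (chi S x * chi T x))"
    using c by (intro sum.cong refl) (simp add: sum_distrib_right mult.assoc)
  also have "\<dots> = (\<Sum>S\<in>F2 n. c S * (\<Sum>x\<in>F2 n. chi S x * chi T x))"
    by (subst sum.swap) (simp add: sum_distrib_left)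
  also have "\<dots> = (\<Sum>S\<in>F2 n. if S = T then c S * 2 ^ n else 0)"
    by (intro sum.cong refl) (simp add: sum_chi_chi T)
  also have "\<dots> = c T * 2 ^ n" using T by simp
  finally show ?thesis by simp
qed

lemma expansion_exists:
  assumes x: "x \<in> F2 n"
  shows "p x = (\<Sum>S\<in>F2 n. ((\<Sum>y\<in>F2 n. p y * chi S y) / 2 ^ n) * chi S x)"
proof -
  have "(\<Sum>S\<in>F2 n. ((\<Sum>y\<in>F2 n. p y * chi S y) / 2 ^ n) * chi S x)
      = (\<Sum>S\<in>F2 n. \<Sum>y\<in>F2 n. p y / 2 ^ n * (chi y S * chi x S))"
    using x by (intro sum.cong refl)
      (simp add: sum_distrib_right sum_divide_distrib chi_commute[where n = n] mult.assoc)
  also have "\<dots> = (\<Sum>y\<in>F2 n. p y / 2 ^ n * (\<Sum>S\<in>F2 n. chi y S * chi x S))"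
    by (subst sum.swap) (simp add: sum_distrib_left)
  also have "\<dots> = (\<Sum>y\<in>F2 n. if y = x then p y else 0)"
    by (intro sum.cong refl) (simp add: sum_chi_chi x)
  also have "\<dots> = p x" using x by simp
  finally show ?thesis by simp
qed

lemma ex1_fourier_expansion:
  "\<exists>!c. c \<in> extensional (F2 n) \<and> (\<forall>x\<in>F2 n. p x = (\<Sum>S\<in>F2 n. c S * chi S x))"
proof (rule ex1I)
  let ?c = "restrict (\<lambda>S. (\<Sum>y\<in>F2 n. p y * chi S y) / 2 ^ n) (F2 n)"
  show "?c \<in> extensional (F2 n) \<and> (\<forall>x\<in>F2 n. p x = (\<Sum>S\<in>F2 n. ?c S * chi S x))"
    using expansion_exists[of _ n p] by simp
  fix c assume "c \<in> extensional (F2 n) \<and> (\<forall>x\<in>F2 n. p x = (\<Sum>S\<in>F2 n. c S * chi S x))"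
  then have c: "c \<in> extensional (F2 n)" "\<forall>x\<in>F2 n. p x = (\<Sum>S\<in>F2 n. c S * chi S x)"
    by (rule conjunct1, rule conjunct2)
  show "c = ?c"
  proof (rule extensionalityI[OF c(1) restrict_extensional])
    fix S :: "bit vec" assume S: "S \<in> F2 n"
    show "c S = ?c S"
      using expansion_unique[OF c(2) S] unfolding restrict_apply'[OF S] .
  qed
qed

lemma fourier_expansion:
  "x \<in> F2 n \<Longrightarrow> p x = (\<Sum>S\<in>F2 n. fourier n p S * chi S x)"
  using theI'[OF ex1_fourier_expansion[of n p]] unfolding fourier_def by blast

lemma fourier_eq:
  "S \<in> F2 n \<Longrightarrow> fourier n p S = (\<Sum>x\<in>F2 n. p x * chi S x) / 2 ^ n"
  using expansion_unique[of n p "fourier n p"] fourier_expansion by blast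

lemma approximants_nonempty: "0 \<le> \<alpha> \<Longrightarrow> {spectral_norm n p | p. approximates n \<alpha> p f} \<noteq> {}"
  by (auto simp: approximates_def intro: exI[of _ f])

lemma approximants_bdd_below: "bdd_below {spectral_norm n p | p. approximates n \<alpha> p f}"
  by (rule bdd_belowI[of _ 0]) (auto simp: spectral_norm_def sum_nonneg)

lemma finite_GL [simp]: "finite (GL n)"
proof -
  have "M \<in> (\<lambda>r. mat_of_rows n (map r [0..<n])) ` ({..<n} \<rightarrow>\<^sub>E F2 n)" if "M \<in> carrier_mat n n" for M
  proof
    show "M = mat_of_rows n (map (restrict (row M) {..<n}) [0..<n])"
      using that by (intro eq_matI) (auto simp: mat_of_rows_def)
    show "restrict (row M) {..<n} \<in> {..<n} \<rightarrow>\<^sub>E F2 n"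
      using that by auto
  qed
  then have "GL n \<subseteq> (\<lambda>r. mat_of_rows n (map r [0..<n])) ` ({..<n} \<rightarrow>\<^sub>E F2 n)"
    by (auto simp: GL_def)
  then show ?thesis
    by (rule finite_subset) (simp add: finite_PiE)
qed

lemma GL_nonempty [simp]: "GL n \<noteq> {}"
proof -
  have "1\<^sub>m n \<in> GL n"
    unfolding GL_def invertible_mat_def inverts_mat_def
    by (auto intro!: exI[of _ "1\<^sub>m n"])
  then show ?thesis by blast
qed

end

theory Submission
  imports Defs "Jordan_Normal_Form.Gauss_Jordan_Elimination"
begin

text \<open>Let \<open>p\<close> approximate \<open>f\<close> with spectral norm at most \<open>2 t\<close>. Signed characters drawn with
  probability proportional to \<open>\<bar>fourier n p S\<bar>\<close> agree with \<open>f\<close> at every point with a bias of order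
  \<open>1 / t\<close>, so the majority of some \<open>k = O(t\<^sup>2 log (1 / \<omega>))\<close> of them differs from \<open>f\<close> on at most
  an \<open>\<omega> / 4\<close> fraction of the points. Gaussian elimination moves \<open>k\<close> vectors into the span of the
  first \<open>k\<close> unit vectors, so up to linear isomorphism there are only \<open>2 ^ (k * (k + 1))\<close> such
  majorities. The player with the smaller norm sends one that is \<open>\<omega> / 4\<close>-close to their own input;
  as the linear isomorphism distance is a pseudometric, the other player can decide.\<close>

section \<open>The linear isomorphism distance is a pseudometric\<close>

lemma GL_I:
  assumes "M \<in> carrier_mat n n" "N \<in> carrier_mat n n" "M * N = 1\<^sub>m n" "N * M = 1\<^sub>m n"
  shows "M \<in> GL n"
  using assms unfolding GL_def invertible_mat_def inverts_mat_def by auto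

lemma GL_carrier: "M \<in> GL n \<Longrightarrow> M \<in> carrier_mat n n"
  by (simp add: GL_def)

lemma GL_inverse:
  assumes "M \<in> GL n"
  obtains N where "N \<in> GL n" "M * N = 1\<^sub>m n" "N * M = 1\<^sub>m n"
proof -
  from assms obtain N where M: "M \<in> carrier_mat n n"
    and inv: "M * N = 1\<^sub>m n" "N * M = 1\<^sub>m (dim_row N)"
    unfolding GL_def invertible_mat_def inverts_mat_def by auto
  have "dim_col N = n" using arg_cong[OF inv(1), of dim_col] by simp
  moreover have "dim_row N = n" using arg_cong[OF inv(2), of dim_col] M by simp
  ultimately have "N \<in> carrier_mat n n" by auto
  with M inv \<open>dim_row N = n\<close> show thesis by (intro that[of N] GL_I[of N n M]) auto
qed

lemma GL_mult:
  assumes "M \<in> GL n" "N \<in> GL n"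
  shows "M * N \<in> GL n"
proof -
  obtain M' where M': "M' \<in> GL n" "M * M' = 1\<^sub>m n" "M' * M = 1\<^sub>m n"
    using GL_inverse assms(1) by blast
  obtain N' where N': "N' \<in> GL n" "N * N' = 1\<^sub>m n" "N' * N = 1\<^sub>m n"
    using GL_inverse assms(2) by blast
  note c = assms[THEN GL_carrier] M'(1)[THEN GL_carrier] N'(1)[THEN GL_carrier]
  have "(M * N) * (N' * M') = M * ((N * N') * M')"
    using c by (simp add: assoc_mult_mat[of _ n n _ n _ n])
  moreover have "(N' * M') * (M * N) = N' * ((M' * M) * N)"
    using c by (simp add: assoc_mult_mat[of _ n n _ n _ n])
  ultimately show ?thesis
    using c M' N' by (intro GL_I[of _ n "N' * M'"]) auto
qed

lemma bij_betw_GL: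
  assumes "M \<in> GL n"
  shows "bij_betw ((*\<^sub>v) M) (F2 n) (F2 n)"
proof -
  obtain N where N: "N \<in> GL n" "M * N = 1\<^sub>m n" "N * M = 1\<^sub>m n"
    using GL_inverse assms by blast
  note c = assms[THEN GL_carrier] N(1)[THEN GL_carrier]
  have "N *\<^sub>v (M *\<^sub>v x) = x" "M *\<^sub>v (N *\<^sub>v x) = x" if "x \<in> F2 n" for x
    using assoc_mult_mat_vec[OF c(2,1) that] assoc_mult_mat_vec[OF c that] N that by auto
  then show ?thesis
    using c by (intro bij_betw_byWitness[where f' = "(*\<^sub>v) N"]) auto
qed

section \<open>Fractional Hamming distance and its invariance under linear bijections\<close>

lemma hamming_distance_cong:
  assumes "\<And>x. x \<in> F2 n \<Longrightarrow> f x = f' x" "\<And>x. x \<in> F2 n \<Longrightarrow> g x = g' x"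
  shows "hamming_distance n f g = hamming_distance n f' g'"
proof -
  have "{x \<in> F2 n. f x \<noteq> g x} = {x \<in> F2 n. f' x \<noteq> g' x}" using assms by auto
  then show ?thesis by (simp add: hamming_distance_def)
qed

lemma hamming_distance_commute: "hamming_distance n f g = hamming_distance n g f"
  unfolding hamming_distance_def by (simp add: eq_commute)

lemma hamming_distance_triangle:
  "hamming_distance n f h \<le> hamming_distance n f g + hamming_distance n g h"
proof -
  have "card {x \<in> F2 n. f x \<noteq> h x} \<le> card ({x \<in> F2 n. f x \<noteq> g x} \<union> {x \<in> F2 n. g x \<noteq> h x})"
    by (rule card_mono) auto
  also have "\<dots> \<le> card {x \<in> F2 n. f x \<noteq> g x} + card {x \<in> F2 n. g x \<noteq> h x}"
    by (rule card_Un_le)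
  finally have "real (card {x \<in> F2 n. f x \<noteq> h x}) \<le>
      real (card {x \<in> F2 n. f x \<noteq> g x}) + real (card {x \<in> F2 n. g x \<noteq> h x})"
    by linarith
  then show ?thesis
    unfolding hamming_distance_def add_divide_distrib[symmetric]
    by (rule divide_right_mono) simp
qed

lemma hamming_distance_GL:
  assumes "M \<in> GL n"
  shows "hamming_distance n (\<lambda>x. f (M *\<^sub>v x)) (\<lambda>x. g (M *\<^sub>v x)) = hamming_distance n f g"
proof -
  have "bij_betw ((*\<^sub>v) M) {x \<in> F2 n. f (M *\<^sub>v x) \<noteq> g (M *\<^sub>v x)} {x \<in> F2 n. f x \<noteq> g x}"
    using bij_betw_GL[OF assms] unfolding bij_betw_def
    by (auto simp: inj_on_def image_iff)
  then show ?thesis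
    unfolding hamming_distance_def by (simp add: bij_betw_same_card)
qed

section \<open>Minimising over the linear group\<close>

lemma linear_iso_distance_le:
  "M \<in> GL n \<Longrightarrow> linear_iso_distance n f g \<le> hamming_distance n (\<lambda>x. f (M *\<^sub>v x)) g"
  unfolding linear_iso_distance_def by (rule Min_le) auto

lemma linear_iso_distance_attained:
  obtains M where "M \<in> GL n"
    "linear_iso_distance n f g = hamming_distance n (\<lambda>x. f (M *\<^sub>v x)) g"
proof -
  have "linear_iso_distance n f g \<in> (\<lambda>M. hamming_distance n (\<lambda>x. f (M *\<^sub>v x)) g) ` GL n"
    unfolding linear_iso_distance_def by (rule Min_in) auto
  then show thesis using that by blast
qed

text \<open>The inverse of a minimiser for one order is a candidate for the other order, and
  substituting a bijection in both arguments leaves the Hamming distance unchanged.\<close>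

lemma linear_iso_distance_le_commute: "linear_iso_distance n f g \<le> linear_iso_distance n g f"
proof -
  obtain M where M: "M \<in> GL n" "linear_iso_distance n g f = hamming_distance n (\<lambda>x. g (M *\<^sub>v x)) f"
    by (rule linear_iso_distance_attained)
  obtain N where N: "N \<in> GL n" "M * N = 1\<^sub>m n" "N * M = 1\<^sub>m n"
    using GL_inverse M by blast
  have MN: "M *\<^sub>v (N *\<^sub>v x) = x" if "x \<in> F2 n" for x
    using assoc_mult_mat_vec[OF M(1)[THEN GL_carrier] N(1)[THEN GL_carrier] that] N that by simp
  have "linear_iso_distance n f g \<le> hamming_distance n (\<lambda>x. f (N *\<^sub>v x)) g"
    by (rule linear_iso_distance_le) fact
  also have "\<dots> = hamming_distance n (\<lambda>x. f (N *\<^sub>v x)) (\<lambda>x. g (M *\<^sub>v (N *\<^sub>v x)))"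
    by (rule hamming_distance_cong) (simp_all add: MN)
  also have "\<dots> = linear_iso_distance n g f"
    using hamming_distance_GL[OF N(1), of f "\<lambda>x. g (M *\<^sub>v x)"] M(2)
    by (simp add: hamming_distance_commute)
  finally show ?thesis .
qed

lemma linear_iso_distance_commute: "linear_iso_distance n f g = linear_iso_distance n g f"
  by (intro antisym linear_iso_distance_le_commute)

text \<open>The product of the two minimisers is a candidate for the outer pair; the first leg is
  measured after substituting \<open>N *\<^sub>v x\<close>, which costs nothing by
  \<open>hamming_distance_GL\<close>.\<close>

lemma linear_iso_distance_triangle:
  "linear_iso_distance n f h \<le> linear_iso_distance n f g + linear_iso_distance n g h"
proof -
  obtain M where M: "M \<in> GL n" "linear_iso_distance n f g = hamming_distance n (\<lambda>x. f (M *\<^sub>v x)) g"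
    by (rule linear_iso_distance_attained)
  obtain N where N: "N \<in> GL n" "linear_iso_distance n g h = hamming_distance n (\<lambda>x. g (N *\<^sub>v x)) h"
    by (rule linear_iso_distance_attained)
  have MN: "M * N *\<^sub>v x = M *\<^sub>v (N *\<^sub>v x)" if "x \<in> F2 n" for x
    using assoc_mult_mat_vec[OF M(1)[THEN GL_carrier] N(1)[THEN GL_carrier] that] .
  have "linear_iso_distance n f h \<le> hamming_distance n (\<lambda>x. f (M * N *\<^sub>v x)) h"
    by (intro linear_iso_distance_le GL_mult M N)
  also have "\<dots> = hamming_distance n (\<lambda>x. f (M *\<^sub>v (N *\<^sub>v x))) h"
    by (rule hamming_distance_cong) (simp_all add: MN)
  also have "\<dots> \<le> hamming_distance n (\<lambda>x. f (M *\<^sub>v (N *\<^sub>v x))) (\<lambda>x. g (N *\<^sub>v x))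
      + hamming_distance n (\<lambda>x. g (N *\<^sub>v x)) h"
    by (rule hamming_distance_triangle)
  also have "\<dots> = linear_iso_distance n f g + linear_iso_distance n g h"
    using hamming_distance_GL[OF N(1), of "\<lambda>x. f (M *\<^sub>v x)" g] M N by simp
  finally show ?thesis .
qed

section \<open>Approximation by the sign of few characters\<close>

text \<open>A list entry is a signed character, the sign being that of a Fourier coefficient. Lists
  keep repetitions, as sampling with replacement would.\<close>

definition vote :: "(real \<times> bit vec) list \<Rightarrow> bit vec \<Rightarrow> real" where
  "vote xs x = (\<Sum>(s, S)\<leftarrow>xs. s * chi S x)"

definition majority :: "(real \<times> bit vec) list \<Rightarrow> bit vec \<Rightarrow> real" where
  "majority xs x = (if vote xs x > 0 then 1 else -1)"

lemma abs_chi: "\<bar>chi S x\<bar> = 1"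
  by (simp add: chi_def power_abs)

lemma approximant_correlation:
  assumes "f \<in> boolean_functions n" "approximates n (1/3) p f" "x \<in> F2 n"
  shows "f x * p x \<ge> 2/3"
proof -
  have "f x = 1 \<or> f x = -1" using assms(1,3) by (auto simp: boolean_functions_def)
  moreover have "\<bar>f x - p x\<bar> \<le> 1/3" using assms(2,3) by (auto simp: approximates_def)
  ultimately show ?thesis by (elim disjE; simp only: abs_le_iff; linarith)
qed

lemma abs_le_spectral_norm:
  assumes "x \<in> F2 n"
  shows "\<bar>p x\<bar> \<le> spectral_norm n p"
proof -
  have "\<bar>p x\<bar> \<le> (\<Sum>S\<in>F2 n. \<bar>fourier n p S * chi S x\<bar>)"
    unfolding fourier_expansion[OF assms, of p] by (rule sum_abs)
  also have "\<dots> = spectral_norm n p" by (simp add: spectral_norm_def abs_mult abs_chi)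
  finally show ?thesis .
qed

text \<open>A lower bound away from 0 makes division by the norm legitimate and later lets additive
  constants be absorbed into powers of \<open>t\<close>.\<close>

lemma approximant_spectral_norm_ge:
  assumes "f \<in> boolean_functions n" "approximates n (1/3) p f"
  shows "spectral_norm n p \<ge> 2/3"
proof -
  let ?x = "0\<^sub>v n :: bit vec"
  have x: "?x \<in> F2 n" by simp
  have "f ?x = 1 \<or> f ?x = -1" using assms(1) x by (auto simp: boolean_functions_def)
  then have "2/3 \<le> \<bar>p ?x\<bar>"
    using approximant_correlation[OF assms x] by auto
  also have "\<dots> \<le> spectral_norm n p" by (rule abs_le_spectral_norm) simp
  finally show ?thesis .
qed

lemma approx_spectral_norm_ge:
  assumes "f \<in> boolean_functions n"
  shows "approx_spectral_norm n (1/3) f \<ge> 2/3"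
  unfolding approx_spectral_norm_def
  by (rule cInf_greatest[OF approximants_nonempty])
    (use approximant_spectral_norm_ge[OF assms] in auto)

text \<open>The strict slack avoids any argument that the infimum is attained.\<close>

lemma approximant_obtain:
  assumes "approx_spectral_norm n (1/3) f < L"
  obtains p where "approximates n (1/3) p f" "spectral_norm n p < L"
proof -
  have "\<exists>z\<in>{spectral_norm n p | p. approximates n (1/3) p f}. z < L"
    using assms unfolding approx_spectral_norm_def
    by (subst (asm) cInf_less_iff[OF approximants_nonempty approximants_bdd_below]) auto
  then show thesis using that by blast
qed

text \<open>For \<open>y = 1\<close> this rests on
  \<open>(1 + l) * (1 - l + l\<^sup>2) = 1 + l ^ 3\<close> and \<open>exp l \<ge> 1 + l\<close>. The
  bound is linear in \<open>y\<close> up to \<open>l\<^sup>2\<close>, so averaging over characters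
  turns it into a statement about \<open>f x * p x\<close>.\<close>

lemma exp_minus_mult_le:
  assumes "0 \<le> (l::real)" "l \<le> 1" "y = 1 \<or> y = -1"
  shows "exp (- l * y) \<le> 1 - l * y + l\<^sup>2"
  using assms(3)
proof
  assume "y = 1"
  have "1 \<le> (1 + l) * (1 - l + l\<^sup>2)" using assms(1) by (simp add: algebra_simps power2_eq_square)
  then have "inverse (1 + l) \<le> 1 - l + l\<^sup>2"
    using assms(1) by (simp add: field_simps)
  moreover have "exp (- l) \<le> inverse (1 + l)"
    unfolding exp_minus using assms(1) exp_ge_add_one_self[of l] by (intro le_imp_inverse_le) auto
  ultimately show ?thesis using \<open>y = 1\<close> by simp
next
  assume "y = -1"
  then show ?thesis using exp_bound[of l] assms by simp
qed

text \<open>Averaging over \<open>S\<close> with weights \<open>\<bar>fourier n p S\<bar>\<close>; together with the induction below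
  this derandomizes the sampling of characters by the method of conditional expectations.\<close>

lemma exists_correlated_character:
  assumes f: "f \<in> boolean_functions n" and p: "approximates n (1/3) p f"
    and L: "spectral_norm n p \<le> L" and W: "\<And>x. x \<in> F2 n \<Longrightarrow> W x \<ge> 0"
    and l: "0 \<le> l" "l \<le> 1"
  shows "\<exists>s\<in>{1, -1}. \<exists>S\<in>F2 n. (\<Sum>x\<in>F2 n. W x * exp (- l * (f x * (s * chi S x))))
     \<le> exp (l\<^sup>2 - l * (2 / (3 * L))) * (\<Sum>x\<in>F2 n. W x)"
proof (rule ccontr)
  define c where "c = fourier n p"
  \<comment> \<open>With this sign \<open>\<bar>c S\<bar> * s S = c S\<close>, so the weighted sum
    of the signed characters is \<open>p\<close> itself. The contradiction is that an average cannot
    stay below a bound that every term exceeds.\<close>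
  define s where "s S = (if c S \<ge> 0 then 1 else -1 :: real)" for S
  define N where "N = spectral_norm n p"
  define \<Phi> where "\<Phi> S = (\<Sum>x\<in>F2 n. W x * exp (- l * (f x * (s S * chi S x))))" for S
  define \<rho> where "\<rho> = exp (l\<^sup>2 - l * (2 / (3 * L)))"
  define R where "R = \<rho> * (\<Sum>x\<in>F2 n. W x)"
  assume "\<not> ?thesis"
  then have gt: "\<Phi> S > R" if "S \<in> F2 n" for S
    using that unfolding \<Phi>_def R_def \<rho>_def s_def by (auto simp: not_le)
  have N: "N \<ge> 2/3" unfolding N_def using approximant_spectral_norm_ge[OF f p] .
  have N_sum: "N = (\<Sum>S\<in>F2 n. \<bar>c S\<bar>)" by (simp add: N_def spectral_norm_def c_def)
  have pointwise: "(\<Sum>S\<in>F2 n. \<bar>c S\<bar> * exp (- l * (f x * (s S * chi S x)))) \<le> N * \<rho>"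
    if x: "x \<in> F2 n" for x
  proof -
    have fx: "f x = 1 \<or> f x = -1" using f x by (auto simp: boolean_functions_def)
    have "(\<Sum>S\<in>F2 n. \<bar>c S\<bar> * exp (- l * (f x * (s S * chi S x))))
        \<le> (\<Sum>S\<in>F2 n. \<bar>c S\<bar> * (1 - l * (f x * (s S * chi S x)) + l\<^sup>2))"
    proof (intro sum_mono mult_left_mono exp_minus_mult_le l)
      fix S
      show "f x * (s S * chi S x) = 1 \<or> f x * (s S * chi S x) = - 1"
        using fx abs_chi[of S x] by (auto simp: s_def abs_if split: if_splits)
    qed auto
    also have "\<dots> = (\<Sum>S\<in>F2 n. (1 + l\<^sup>2) * \<bar>c S\<bar> - l * f x * (c S * chi S x))"
      by (intro sum.cong refl) (auto simp: s_def algebra_simps)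
    also have "\<dots> = (1 + l\<^sup>2) * N - l * (f x * p x)"
      using fourier_expansion[OF x, of p]
      by (simp add: sum_subtractf sum_distrib_left[symmetric] N_sum c_def mult.assoc)
    also have "\<dots> \<le> (1 + l\<^sup>2) * N - l * (2/3)"
      using approximant_correlation[OF f p x] l by (intro diff_mono mult_left_mono) auto
    also have "\<dots> \<le> (1 + l\<^sup>2) * N - l * (N * (2 / (3 * L)))"
    proof -
      have "N * (2 / (3 * L)) \<le> 2/3" using N L by (simp add: N_def field_simps)
      then show ?thesis using l by (intro diff_mono mult_left_mono) auto
    qed
    also have "\<dots> = N * (1 + (l\<^sup>2 - l * (2 / (3 * L))))" by (simp add: algebra_simps)
    also have "\<dots> \<le> N * \<rho>"
      unfolding \<rho>_def using N by (intro mult_left_mono exp_ge_add_one_self) auto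
    finally show ?thesis .
  qed
  have "(\<Sum>S\<in>F2 n. \<bar>c S\<bar> * \<Phi> S)
      = (\<Sum>x\<in>F2 n. W x * (\<Sum>S\<in>F2 n. \<bar>c S\<bar> * exp (- l * (f x * (s S * chi S x)))))"
    unfolding \<Phi>_def sum_distrib_left by (subst sum.swap) (simp add: mult.left_commute)
  also have "\<dots> \<le> (\<Sum>x\<in>F2 n. W x * (N * \<rho>))"
    by (intro sum_mono mult_left_mono pointwise W)
  also have "\<dots> = (\<Sum>S\<in>F2 n. \<bar>c S\<bar> * R)"
    unfolding R_def N_sum sum_distrib_right[symmetric] by (simp only: ac_simps)
  finally have "(\<Sum>S\<in>F2 n. \<bar>c S\<bar> * \<Phi> S) \<le> (\<Sum>S\<in>F2 n. \<bar>c S\<bar> * R)" .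
  \<comment> \<open>Strictness needs one character of positive weight, which exists because the norm
    is at least 2/3.\<close>
  moreover have "(\<Sum>S\<in>F2 n. \<bar>c S\<bar> * R) < (\<Sum>S\<in>F2 n. \<bar>c S\<bar> * \<Phi> S)"
  proof (rule sum_strict_mono_ex1)
    show "\<forall>S\<in>F2 n. \<bar>c S\<bar> * R \<le> \<bar>c S\<bar> * \<Phi> S"
      using less_imp_le[OF gt] by (simp add: mult_left_mono)
    have "\<exists>S\<in>F2 n. c S \<noteq> 0"
      using N by (rule contrapos_pp) (simp add: N_sum)
    then obtain S where "S \<in> F2 n" "c S \<noteq> 0" by blast
    then show "\<exists>S\<in>F2 n. \<bar>c S\<bar> * R < \<bar>c S\<bar> * \<Phi> S"
      using gt by (intro bexI[of _ S] mult_strict_left_mono) auto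
  qed simp
  ultimately show False by simp
qed

text \<open>The potential \<open>\<Sum>x\<in>F2 n. exp (- l * (f x * vote xs x))\<close> starts at
  \<open>2 ^ n\<close>, and a well chosen character multiplies it by at most the given factor. Each
  point where the majority errs contributes at least 1, so the potential bounds the number of
  errors.\<close>

lemma exists_majority_approximation:
  assumes f: "f \<in> boolean_functions n" and p: "approximates n (1/3) p f"
    and L: "spectral_norm n p \<le> L" and l: "0 \<le> l" "l \<le> 1"
  shows "\<exists>xs. length xs = k \<and> set xs \<subseteq> {1, -1} \<times> F2 n \<and>
    hamming_distance n f (majority xs) \<le> exp (l\<^sup>2 - l * (2 / (3 * L))) ^ k"
proof -
  define \<rho> where "\<rho> = exp (l\<^sup>2 - l * (2 / (3 * L)))"
  have "\<exists>xs. length xs = k \<and> set xs \<subseteq> {1, -1} \<times> F2 n \<and>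
    (\<Sum>x\<in>F2 n. exp (- l * (f x * vote xs x))) \<le> \<rho> ^ k * 2 ^ n"
  proof (induction k)
    case 0
    show ?case by (simp add: vote_def)
  next
    case (Suc k)
    then obtain xs where xs: "length xs = k" "set xs \<subseteq> {1, -1} \<times> F2 n"
      "(\<Sum>x\<in>F2 n. exp (- l * (f x * vote xs x))) \<le> \<rho> ^ k * 2 ^ n" by blast
    obtain s S where s: "s \<in> {1, -1}" "S \<in> F2 n"
      and le: "(\<Sum>x\<in>F2 n. exp (- l * (f x * vote xs x)) * exp (- l * (f x * (s * chi S x))))
        \<le> \<rho> * (\<Sum>x\<in>F2 n. exp (- l * (f x * vote xs x)))"
      \<comment> \<open>The weight of a point is its current contribution to the potential, so
        points where the vote so far goes wrong count most.\<close>
      using exists_correlated_character[OF f p L exp_ge_zero l, of "\<lambda>x. - l * (f x * vote xs x)"]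
      unfolding \<rho>_def by blast
    have "(\<Sum>x\<in>F2 n. exp (- l * (f x * vote ((s, S) # xs) x)))
        = (\<Sum>x\<in>F2 n. exp (- l * (f x * vote xs x)) * exp (- l * (f x * (s * chi S x))))"
      by (simp add: vote_def exp_add[symmetric] algebra_simps)
    also have "\<dots> \<le> \<rho> * (\<Sum>x\<in>F2 n. exp (- l * (f x * vote xs x)))" by (rule le)
    also have "\<dots> \<le> \<rho> * (\<rho> ^ k * 2 ^ n)"
      by (intro mult_left_mono xs) (simp add: \<rho>_def)
    finally show ?case
      using xs s by (intro exI[of _ "(s, S) # xs"]) (auto simp: mult.assoc)
  qed
  then obtain xs where xs: "length xs = k" "set xs \<subseteq> {1, -1} \<times> F2 n"
    "(\<Sum>x\<in>F2 n. exp (- l * (f x * vote xs x))) \<le> \<rho> ^ k * 2 ^ n" by blast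
  let ?E = "{x \<in> F2 n. f x \<noteq> majority xs x}"
  have "real (card ?E) = (\<Sum>x\<in>?E. 1)" by simp
  also have "\<dots> \<le> (\<Sum>x\<in>?E. exp (- l * (f x * vote xs x)))"
  proof (rule sum_mono)
    fix x assume x: "x \<in> ?E"
    then have "f x = 1 \<or> f x = -1" using f by (auto simp: boolean_functions_def)
    with x have "f x * vote xs x \<le> 0" by (auto simp: majority_def split: if_splits)
    from mult_nonneg_nonpos[OF l(1) this] show "1 \<le> exp (- l * (f x * vote xs x))" by (simp only: mult_minus_left one_le_exp_iff neg_0_le_iff_le)
  qed
  also have "\<dots> \<le> (\<Sum>x\<in>F2 n. exp (- l * (f x * vote xs x)))"
    by (rule sum_mono2) auto
  also have "\<dots> \<le> \<rho> ^ k * 2 ^ n" by (rule xs)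
  finally have "hamming_distance n f (majority xs) \<le> \<rho> ^ k"
    by (simp add: hamming_distance_def field_simps)
  with xs show ?thesis unfolding \<rho>_def by blast
qed

section \<open>Few characters up to linear isomorphism\<close>

text \<open>The span of the first \<open>k\<close> unit vectors; for \<open>k \<ge> n\<close> it is
  all of \<open>F2 n\<close>, so no case distinction on \<open>k\<close> is needed later.\<close>

definition initial_vecs :: "nat \<Rightarrow> nat \<Rightarrow> bit vec set" where
  "initial_vecs n k = {S \<in> F2 n. \<forall>i<n. k \<le> i \<longrightarrow> S $ i = 0}"

lemma finite_initial_vecs: "finite (initial_vecs n k)"
  by (rule finite_subset[OF _ finite_F2[of n]]) (auto simp: initial_vecs_def)

lemma card_initial_vecs_le: "card (initial_vecs n k) \<le> 2 ^ k"
proof -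
  have "inj_on (\<lambda>S. {i. i < n \<and> S $ i = 1}) (initial_vecs n k)"
  proof (rule inj_onI)
    fix S T :: "bit vec"
    assume S: "S \<in> initial_vecs n k" and T: "T \<in> initial_vecs n k"
      and eq: "{i. i < n \<and> S $ i = 1} = {i. i < n \<and> T $ i = 1}"
    show "S = T"
    proof (rule eq_vecI)
      show "dim_vec S = dim_vec T" using S T by (auto simp: initial_vecs_def)
      fix i assume "i < dim_vec T"
      then have "S $ i = 1 \<longleftrightarrow> T $ i = 1" using eq T by (auto simp: initial_vecs_def)
      then show "S $ i = T $ i" by (cases "S $ i"; cases "T $ i") auto
    qed
  qed
  moreover have "(\<lambda>S. {i. i < n \<and> S $ i = 1}) ` initial_vecs n k \<subseteq> Pow {..<k}"
    by (auto simp: initial_vecs_def not_less[symmetric])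
  ultimately have "card (initial_vecs n k) \<le> card (Pow {..<k})"
    by (intro card_inj_on_le) auto
  then show ?thesis by (simp add: card_Pow)
qed

text \<open>Pivot columns move right by at least one per row, so from row \<open>k\<close> on no
  column is left for a pivot.\<close>

lemma row_echelon_form_zero_rows:
  assumes A: "A \<in> carrier_mat n k" and e: "row_echelon_form A"
    and i: "i < n" "k \<le> i" and j: "j < k"
  shows "A $$ (i, j) = 0"
proof -
  obtain g where g: "pivot_fun A g k" using e A by (auto simp: row_echelon_form_def)
  have "g (0 + i) = k \<or> g (0 + i) \<ge> i + g 0"
    using A i by (intro pivot_bound[OF _ g, of n]) auto
  moreover have "dim_row A = n" using A by simp
  ultimately show ?thesis
    using pivot_funD(2)[OF _ g, of n i j] i j by auto
qed

text \<open>Write the vectors as columns of a matrix and row reduce it: the transforming matrix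
  sends each vector to a column of the echelon form, whose rows from \<open>length Ss\<close> on
  vanish.\<close>

lemma exists_GL_initial_vecs:
  assumes "set Ss \<subseteq> F2 n"
  shows "\<exists>P\<in>GL n. \<forall>S\<in>set Ss. P *\<^sub>v S \<in> initial_vecs n (length Ss)"
proof -
  define A where "A = mat_of_cols n Ss"
  have A: "A \<in> carrier_mat n (length Ss)" by (simp add: A_def)
  define C where "C = gauss_jordan_single A"
  note gj = gauss_jordan_single[OF A C_def[symmetric]]
  obtain P Q where P: "C = P * A" "P \<in> carrier_mat n n" "Q \<in> carrier_mat n n"
    "P * Q = 1\<^sub>m n" "Q * P = 1\<^sub>m n" using gj(4) by blast
  have "P *\<^sub>v (Ss ! j) \<in> initial_vecs n (length Ss)" if j: "j < length Ss" for j
  proof -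
    have Sj: "Ss ! j \<in> F2 n" using assms j by auto
    have "P *\<^sub>v (Ss ! j) = col C j"
      using P(1,2) A j Sj by (simp add: A_def col_mult2[of P n n _ "length Ss"])
    moreover have "C $$ (i, j) = 0" if "i < n" "length Ss \<le> i" for i
      using row_echelon_form_zero_rows[OF gj(2,3) that j] .
    ultimately show ?thesis
      using gj(2) j by (auto simp: initial_vecs_def)
  qed
  moreover have "P \<in> GL n" using P by (intro GL_I)
  ultimately show ?thesis by (intro bexI[of _ P] ballI) (auto simp: in_set_conv_nth)
qed

definition canonical_majorities :: "nat \<Rightarrow> nat \<Rightarrow> (bit vec \<Rightarrow> real) set" where
  "canonical_majorities n k =
     majority ` {xs. set xs \<subseteq> {1, -1} \<times> initial_vecs n k \<and> length xs = k}"

lemma finite_canonical_majorities: "finite (canonical_majorities n k)"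
  unfolding canonical_majorities_def
  by (intro finite_imageI finite_lists_length_eq finite_cartesian_product finite_initial_vecs) simp

lemma card_canonical_majorities_le: "card (canonical_majorities n k) \<le> 2 ^ (k * (k + 1))"
proof -
  let ?D = "{1, -1 :: real} \<times> initial_vecs n k"
  have fin: "finite ?D" by (simp add: finite_initial_vecs)
  have "card (canonical_majorities n k) \<le> card {xs. set xs \<subseteq> ?D \<and> length xs = k}"
    unfolding canonical_majorities_def
    by (intro card_image_le finite_lists_length_eq fin)
  also have "\<dots> = card ?D ^ k" by (rule card_lists_length_eq[OF fin])
  also have "\<dots> \<le> (2 ^ (k + 1)) ^ k"
    using card_initial_vecs_le[of n k] by (intro power_mono) (auto simp: card_cartesian_product)
  also have "\<dots> = 2 ^ (k * (k + 1))" by (simp only: power_mult[symmetric] mult.commute)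
  finally show ?thesis .
qed

text \<open>Since \<open>chi S (transpose_mat P *\<^sub>v x) = chi (P *\<^sub>v S) x\<close>, a
  change of variables by the transpose moves all characters of the majority by \<open>P\<close>,
  which is chosen to carry them into the initial span.\<close>

lemma exists_canonical_majority:
  assumes "set xs \<subseteq> {1, -1} \<times> F2 n"
  shows "\<exists>h\<in>canonical_majorities n (length xs).
    linear_iso_distance n f h \<le> hamming_distance n f (majority xs)"
proof -
  have "set (map snd xs) \<subseteq> F2 n" using assms by auto
  from exists_GL_initial_vecs[OF this] obtain P where P: "P \<in> GL n"
    and init: "\<And>x. x \<in> set xs \<Longrightarrow> P *\<^sub>v snd x \<in> initial_vecs n (length xs)" by auto
  define ys where "ys = map (\<lambda>(s, S). (s, P *\<^sub>v S)) xs"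
  obtain Q where Q: "Q \<in> GL n" "P * Q = 1\<^sub>m n" "Q * P = 1\<^sub>m n"
    using GL_inverse P by blast
  note c = P[THEN GL_carrier] Q(1)[THEN GL_carrier]
  have PT: "transpose_mat P \<in> GL n"
    using c Q by (intro GL_I[of _ n "transpose_mat Q"])
      (auto simp: transpose_mult[OF c(1,2), symmetric] transpose_mult[OF c(2,1), symmetric])
  have chi_transpose: "chi S (transpose_mat P *\<^sub>v x) = chi (P *\<^sub>v S) x" if "S \<in> F2 n" "x \<in> F2 n" for S x
  proof -
    have "S \<bullet> (transpose_mat P *\<^sub>v x) = (transpose_mat P *\<^sub>v x) \<bullet> S"
      using c that by (intro comm_scalar_prod[of _ n]) auto
    also have "\<dots> = x \<bullet> (P *\<^sub>v S)"
      using c that by (intro transpose_vec_mult_scalar) auto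
    also have "\<dots> = (P *\<^sub>v S) \<bullet> x"
      using c that by (intro comm_scalar_prod[of _ n]) auto
    finally show ?thesis by (simp add: chi_def)
  qed
  have maj: "majority xs (transpose_mat P *\<^sub>v x) = majority ys x" if "x \<in> F2 n" for x
  proof -
    have "vote xs (transpose_mat P *\<^sub>v x) = vote ys x"
      unfolding vote_def ys_def map_map using assms that chi_transpose
      by (intro arg_cong[where f = sum_list] map_cong) auto
    then show ?thesis by (simp add: majority_def)
  qed
  have "linear_iso_distance n f (majority ys)
      \<le> hamming_distance n (\<lambda>x. f (transpose_mat P *\<^sub>v x)) (majority ys)"
    by (rule linear_iso_distance_le[OF PT])
  also have "\<dots> = hamming_distance n f (majority xs)"
    unfolding hamming_distance_GL[OF PT, of f "majority xs", symmetric]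
    by (rule hamming_distance_cong) (simp_all add: maj)
  finally have "linear_iso_distance n f (majority ys) \<le> hamming_distance n f (majority xs)" .
  moreover have "majority ys \<in> canonical_majorities n (length xs)"
    unfolding canonical_majorities_def using assms init
    by (intro imageI) (fastforce simp: ys_def)
  ultimately show ?thesis by blast
qed

lemma near_canonical_majority:
  assumes f: "f \<in> boolean_functions n" and w: "\<omega> > 0"
    and k: "real k \<ge> 36 * (approx_spectral_norm n (1/3) f)\<^sup>2 * ln (4 / \<omega>)"
  shows "\<exists>h\<in>canonical_majorities n k. linear_iso_distance n f h \<le> \<omega> / 4"
proof -
  define t where "t = approx_spectral_norm n (1/3) f"
  have t: "t \<ge> 2/3" unfolding t_def by (rule approx_spectral_norm_ge[OF f])
  then have "approx_spectral_norm n (1/3) f < 2 * t" by (simp add: t_def)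
  then obtain p where p: "approximates n (1/3) p f" "spectral_norm n p < 2 * t"
    by (rule approximant_obtain)
  \<comment> \<open>For the norm bound \<open>L = 2 * t\<close> the exponent is
    \<open>l\<^sup>2 - l / (3 * t)\<close>, minimised at this \<open>l\<close> with value
    \<open>- 1 / (36 * t\<^sup>2)\<close>; hence the constant 36 in the choice of
    \<open>k\<close>.\<close>
  let ?l = "1 / (6 * t)"
  have l: "0 \<le> ?l" "?l \<le> 1" using t by auto
  have exponent: "?l\<^sup>2 - ?l * (2 / (3 * (2 * t))) = - 1 / (36 * t\<^sup>2)"
    using t by (simp add: field_simps power2_eq_square)
  obtain xs where xs: "length xs = k" "set xs \<subseteq> {1, -1} \<times> F2 n"
    "hamming_distance n f (majority xs) \<le> exp (- 1 / (36 * t\<^sup>2)) ^ k"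
    using exists_majority_approximation[OF f p(1) less_imp_le[OF p(2)] l, of k]
    unfolding exponent by blast
  have "ln (4 / \<omega>) \<le> real k / (36 * t\<^sup>2)"
    using k t by (simp add: t_def[symmetric] field_simps)
  then have "exp (- (real k / (36 * t\<^sup>2))) \<le> exp (- ln (4 / \<omega>))" by simp
  also have "\<dots> = \<omega> / 4" using w by (simp add: exp_minus)
  also have "exp (- (real k / (36 * t\<^sup>2))) = exp (- 1 / (36 * t\<^sup>2)) ^ k"
    by (simp add: exp_of_nat_mult[symmetric])
  finally have "hamming_distance n f (majority xs) \<le> \<omega> / 4" using xs(3) by linarith
  then show ?thesis
    using exists_canonical_majority[OF xs(2), of f] order_trans unfolding xs(1) by blast
qed

section \<open>Protocols\<close>

text \<open>Each bit tells which half of the remaining candidates contains \<open>e x\<close>.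
  Exactly \<open>m\<close> bits are sent even when fewer would do, and after them the protocol may
  depend on \<open>e x\<close> as if Bob knew it.\<close>

lemma Alice_sends:
  assumes "finite D" "card D \<le> 2 ^ m"
  shows "\<exists>P. \<forall>x y. e x \<in> D \<longrightarrow> answer P x y = answer (Q (e x)) x y \<and>
    bits_exchanged P x y = m + bits_exchanged (Q (e x)) x y"
  using assms
proof (induction m arbitrary: D)
  case 0
  then have "card D \<le> Suc 0" "finite D" by simp_all
  then obtain d where "D \<subseteq> {d}" unfolding card_le_Suc0_iff_eq[OF \<open>finite D\<close>] by blast
  \<comment> \<open>An empty \<open>D\<close> is covered as well: the premise
    \<open>e x \<in> D\<close> is then false and any protocol will do.\<close>
  then show ?case by (intro exI[of _ "Q d"]) auto
next
  case (Suc m)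
  obtain D1 D2 where D: "D = D1 \<union> D2" "card D1 \<le> 2 ^ m" "card D2 \<le> 2 ^ m" "finite D1" "finite D2"
  proof (cases "card D \<le> 2 ^ m")
    case True
    then show thesis using Suc.prems by (intro that[of D "{}"]) auto
  next
    case False
    then obtain D1 where "D1 \<subseteq> D" "card D1 = 2 ^ m"
      by (metis obtain_subset_with_card_n nat_le_linear)
    then show thesis using Suc.prems
      by (intro that[of D1 "D - D1"]) (auto simp: card_Diff_subset finite_subset)
  qed
  obtain P1 where P1: "\<forall>x y. e x \<in> D1 \<longrightarrow> answer P1 x y = answer (Q (e x)) x y \<and>
    bits_exchanged P1 x y = m + bits_exchanged (Q (e x)) x y" using Suc.IH[OF D(4,2)] by blast
  obtain P2 where P2: "\<forall>x y. e x \<in> D2 \<longrightarrow> answer P2 x y = answer (Q (e x)) x y \<and>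
    bits_exchanged P2 x y = m + bits_exchanged (Q (e x)) x y" using Suc.IH[OF D(5,3)] by blast
  show ?case
    using P1 P2 D(1) by (intro exI[of _ "Alice (\<lambda>x. e x \<in> D1) P1 P2"]) auto
qed

primrec swap_players :: "('x, 'y) protocol \<Rightarrow> ('y, 'x) protocol" where
  "swap_players (Output b) = Output b"
| "swap_players (Alice a P Q) = Bob a (swap_players P) (swap_players Q)"
| "swap_players (Bob b P Q) = Alice b (swap_players P) (swap_players Q)"

lemma answer_swap_players [simp]: "answer (swap_players P) y x = answer P x y"
  by (induction P) auto

lemma bits_exchanged_swap_players [simp]: "bits_exchanged (swap_players P) y x = bits_exchanged P x y"
  by (induction P) auto

text \<open>The extra bit is Bob's verdict, which has to be sent because the output is fixed by the
  transcript.\<close>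

lemma Alice_sends_and_Bob_answers:
  assumes "finite D" "card D \<le> 2 ^ m"
  shows "\<exists>P. \<forall>x y. e x \<in> D \<longrightarrow> answer P x y = b (e x) y \<and> bits_exchanged P x y = m + 1"
proof -
  obtain P where P: "\<forall>x y. e x \<in> D \<longrightarrow>
    answer P x y = answer (Bob (b (e x)) (Output True) (Output False)) x y \<and>
    bits_exchanged P x y = m + bits_exchanged (Bob (b (e x)) (Output True) (Output False)) x y"
    using Alice_sends[OF assms, of e "\<lambda>d. Bob (b d) (Output True) (Output False)"] by blast
  show ?thesis by (intro exI[of _ P]) (simp add: P)
qed

lemma Bob_sends_and_Alice_answers:
  assumes "finite D" "card D \<le> 2 ^ m"
  shows "\<exists>P. \<forall>x y. e y \<in> D \<longrightarrow> answer P x y = b (e y) x \<and> bits_exchanged P x y = m + 1"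
proof -
  obtain P where "\<forall>y x. e y \<in> D \<longrightarrow> answer P y x = b (e y) x \<and> bits_exchanged P y x = m + 1"
    using Alice_sends_and_Bob_answers[OF assms, of e b] by blast
  then show ?thesis by (intro exI[of _ "swap_players P"]) auto
qed

text \<open>The players try \<open>k = i, i + 1, \<dots>\<close> in turn, so that the cost is governed by the smallest
  parameter that suits either of them, although none of them knows it.\<close>

lemma interleaved_search:
  fixes A :: "nat \<Rightarrow> 'x \<Rightarrow> bool" and B :: "nat \<Rightarrow> 'y \<Rightarrow> bool" and cost :: "nat \<Rightarrow> nat"
  assumes mono: "mono cost" and
    RA: "\<And>k. \<exists>P. \<forall>x\<in>X. \<forall>y\<in>Y. A k x \<longrightarrow> ok x y (answer P x y) \<and> bits_exchanged P x y \<le> cost k" and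
    RB: "\<And>k. \<exists>P. \<forall>x\<in>X. \<forall>y\<in>Y. B k y \<longrightarrow> ok x y (answer P x y) \<and> bits_exchanged P x y \<le> cost k"
  shows "\<exists>P. \<forall>x\<in>X. \<forall>y\<in>Y. \<forall>k\<in>{i..<i + r}. A k x \<or> B k y \<longrightarrow>
    ok x y (answer P x y) \<and> bits_exchanged P x y \<le> 2 * (k + 1 - i) + cost k"
proof (induction r arbitrary: i)
  case 0
  show ?case by simp
next
  case (Suc r)
  obtain P where P: "\<And>x y k. x \<in> X \<Longrightarrow> y \<in> Y \<Longrightarrow> Suc i \<le> k \<Longrightarrow> k < Suc i + r \<Longrightarrow> A k x \<or> B k y \<Longrightarrow>
    ok x y (answer P x y) \<and> bits_exchanged P x y \<le> 2 * (k + 1 - Suc i) + cost k"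
    using Suc.IH[of "Suc i"] by (auto simp: Ball_def)
  obtain PA where PA: "\<And>x y. x \<in> X \<Longrightarrow> y \<in> Y \<Longrightarrow> A i x \<Longrightarrow>
    ok x y (answer PA x y) \<and> bits_exchanged PA x y \<le> cost i" using RA[of i] by blast
  obtain PB where PB: "\<And>x y. x \<in> X \<Longrightarrow> y \<in> Y \<Longrightarrow> B i y \<Longrightarrow>
    ok x y (answer PB x y) \<and> bits_exchanged PB x y \<le> cost i" using RB[of i] by blast
  \<comment> \<open>Each failed round costs two bits, one refusal from each player; this gives the
    term \<open>2 * (k + 1 - i)\<close>.\<close>
  let ?P = "Alice (A i) PA (Bob (B i) PB P)"
  show ?case
  proof (intro exI[of _ ?P] ballI impI)
    fix x y k assume x: "x \<in> X" and y: "y \<in> Y" and k: "k \<in> {i..<i + Suc r}" and AB: "A k x \<or> B k y"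
    \<comment> \<open>The search may succeed before reaching the given \<open>k\<close>;
      monotonicity then still yields the bound for \<open>k\<close>.\<close>
    have cost: "cost i \<le> cost k" using mono k by (auto simp: mono_def)
    show "ok x y (answer ?P x y) \<and> bits_exchanged ?P x y \<le> 2 * (k + 1 - i) + cost k"
    proof (cases "A i x \<or> B i y")
      case True
      then show ?thesis using PA[OF x y] PB[OF x y] cost k by auto
    next
      case False
      with AB k have "Suc i \<le> k" "k < Suc i + r" by (auto simp: le_less Suc_le_eq)
      then show ?thesis using P[OF x y _ _ AB] False by auto
    qed
  qed
qed

section \<open>The isomorphism testing protocol and its cost\<close>

lemma isomorphism_protocol:
  fixes n :: nat and \<epsilon> \<omega> :: real
  assumes w: "\<omega> > 0"
  defines "near \<equiv> \<lambda>k f. \<exists>h\<in>canonical_majorities n k. linear_iso_distance n f h \<le> \<omega> / 4"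
  shows "\<exists>P. solves_promise P (boolean_functions n) (boolean_functions n)
      (\<lambda>f g. linear_iso_distance n f g \<le> \<epsilon>) (\<lambda>f g. linear_iso_distance n f g \<ge> \<epsilon> + \<omega>) \<and>
    (\<forall>f\<in>boolean_functions n. \<forall>g\<in>boolean_functions n. \<forall>k. near k f \<or> near k g \<longrightarrow>
      bits_exchanged P f g \<le> 3 * (k + 1)\<^sup>2)"
proof -
  let ?X = "boolean_functions n"
  let ?d = "linear_iso_distance n"
  define ok where "ok f g a \<longleftrightarrow> (?d f g \<le> \<epsilon> \<longrightarrow> a) \<and> (?d f g \<ge> \<epsilon> + \<omega> \<longrightarrow> \<not> a)" for f g a
  define cost where "cost k = k * (k + 1) + 1" for k :: nat
  define e where "e k f = (SOME h. h \<in> canonical_majorities n k \<and> ?d f h \<le> \<omega> / 4)" for k f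
  have e: "e k f \<in> canonical_majorities n k" "?d f (e k f) \<le> \<omega> / 4" if "near k f" for k f
    using someI_ex[of "\<lambda>h. h \<in> canonical_majorities n k \<and> ?d f h \<le> \<omega> / 4"] that
    unfolding near_def e_def by auto
  \<comment> \<open>Replacing \<open>f\<close> by \<open>e k f\<close> shifts the distance by at
    most \<open>\<omega> / 4\<close>, so the two cases become at most
    \<open>\<epsilon> + \<omega> / 4\<close> and at least
    \<open>\<epsilon> + 3 * \<omega> / 4\<close>, still separated by the threshold.\<close>
  have ok: "ok f g (?d (e k f) g \<le> \<epsilon> + \<omega> / 4)" if "near k f" for k f g
    using e(2)[OF that] w linear_iso_distance_triangle[of n "e k f" g f]
      linear_iso_distance_triangle[of n f g "e k f"] linear_iso_distance_commute[of n f "e k f"]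
    unfolding ok_def by auto
  have ok': "ok f g (?d (e k g) f \<le> \<epsilon> + \<omega> / 4)" if "near k g" for k f g
    using ok[OF that, of f] unfolding ok_def by (simp add: linear_iso_distance_commute[of n f g])
  have RA: "\<exists>P. \<forall>f\<in>?X. \<forall>g\<in>?X. near k f \<longrightarrow> ok f g (answer P f g) \<and> bits_exchanged P f g \<le> cost k"
    for k
  proof -
    obtain P where "\<forall>f g. e k f \<in> canonical_majorities n k \<longrightarrow>
      answer P f g = (?d (e k f) g \<le> \<epsilon> + \<omega> / 4) \<and> bits_exchanged P f g = k * (k + 1) + 1"
      using Alice_sends_and_Bob_answers[OF finite_canonical_majorities[of n k]
        card_canonical_majorities_le, of "e k" "\<lambda>h g. ?d h g \<le> \<epsilon> + \<omega> / 4"] by blast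
    then show ?thesis
      using e(1) ok by (intro exI[of _ P]) (simp add: cost_def)
  qed
  have RB: "\<exists>P. \<forall>f\<in>?X. \<forall>g\<in>?X. near k g \<longrightarrow> ok f g (answer P f g) \<and> bits_exchanged P f g \<le> cost k"
    for k
  proof -
    obtain P where "\<forall>f g. e k g \<in> canonical_majorities n k \<longrightarrow>
      answer P f g = (?d (e k g) f \<le> \<epsilon> + \<omega> / 4) \<and> bits_exchanged P f g = k * (k + 1) + 1"
      using Bob_sends_and_Alice_answers[OF finite_canonical_majorities[of n k]
        card_canonical_majorities_le, of "e k" "\<lambda>h f. ?d h f \<le> \<epsilon> + \<omega> / 4"] by blast
    then show ?thesis
      using e(1) ok' by (intro exI[of _ P]) (simp add: cost_def)
  qed
  have "\<exists>k. near k f" if "f \<in> ?X" for f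
    using near_canonical_majority[OF that w real_nat_ceiling_ge] unfolding near_def by blast
  then obtain \<kappa> where \<kappa>: "\<And>f. f \<in> ?X \<Longrightarrow> near (\<kappa> f) f" by metis
  have "finite ?X" unfolding boolean_functions_def by (simp add: finite_PiE)
  \<comment> \<open>A protocol tree is finite, so the search is cut off at a parameter that suits
    every input; inserting 0 keeps the set visibly nonempty.\<close>
  define K where "K = Max (insert 0 (\<kappa> ` ?X))"
  have K: "\<kappa> f \<le> K" if "f \<in> ?X" for f
    unfolding K_def using \<open>finite ?X\<close> that by (intro Max_ge) auto
  have "mono cost" unfolding cost_def by (intro monoI add_mono mult_le_mono) auto
  from interleaved_search[OF this RA RB, of 0 "K + 1"] obtain P where
    "\<forall>f\<in>?X. \<forall>g\<in>?X. \<forall>k\<in>{0..<0 + (K + 1)}. near k f \<or> near k g \<longrightarrow>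
      ok f g (answer P f g) \<and> bits_exchanged P f g \<le> 2 * (k + 1 - 0) + cost k" ..
  moreover have "k \<in> {0..<0 + (K + 1)} \<longleftrightarrow> k \<le> K" for k by auto
  ultimately have P: "ok f g (answer P f g) \<and> bits_exchanged P f g \<le> 2 * (k + 1) + cost k"
    if "f \<in> ?X" "g \<in> ?X" "k \<le> K" "near k f \<or> near k g" for f g k
    using that by (metis diff_zero)
  have "2 * (k + 1) + cost k \<le> 3 * (k + 1)\<^sup>2" for k
    by (simp add: cost_def power2_eq_square algebra_simps)
  then have bits: "bits_exchanged P f g \<le> 3 * (k + 1)\<^sup>2"
    if "f \<in> ?X" "g \<in> ?X" "near k f \<or> near k g" "k \<le> K" for f g k
    using P[OF that(1,2,4,3)] order_trans by blast
  have "bits_exchanged P f g \<le> 3 * (k + 1)\<^sup>2"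
    if fg: "f \<in> ?X" "g \<in> ?X" and near: "near k f \<or> near k g" for f g k
  proof (cases "k \<le> K")
    case True
    then show ?thesis using bits fg near by blast
  next
    \<comment> \<open>For \<open>k\<close> beyond the cutoff, the suitable parameter
      \<open>\<kappa> f \<le> K\<close> already gives a smaller bound.\<close>
    case False
    have "bits_exchanged P f g \<le> 3 * (\<kappa> f + 1)\<^sup>2" using bits fg \<kappa> K by blast
    also have "\<dots> \<le> 3 * (k + 1)\<^sup>2"
      using K[OF fg(1)] False by (intro mult_le_mono power_mono) auto
    finally show ?thesis .
  qed
  moreover have "ok f g (answer P f g)" if "f \<in> ?X" "g \<in> ?X" for f g
    using P[OF that] \<kappa> K that by blast
  ultimately show ?thesis
    unfolding solves_promise_def ok_def by (intro exI[of _ P]) auto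
qed

text \<open>The maximum with 1 keeps the bound meaningful when \<open>\<omega>\<close> is close to
  or above 1, where the logarithm is small or negative.\<close>

lemma sketch_size_le:
  fixes t \<omega> :: real
  assumes t: "t \<ge> 2/3" and w: "\<omega> > 0"
  defines "k \<equiv> nat \<lceil>36 * t\<^sup>2 * ln (4 / \<omega>)\<rceil>"
  shows "3 * (real k + 1)\<^sup>2 \<le> 40000 * (t ^ 4 * (max 1 (log 2 (1 / \<omega>))) ^ 2)"
proof -
  define l where "l = max 1 (log 2 (1 / \<omega>))"
  have l: "l \<ge> 1" "log 2 (1 / \<omega>) \<le> l" by (auto simp: l_def)
  have ln2: "0 < ln (2::real)" "ln (2::real) \<le> 1" using ln_le_minus_one[of 2] by auto
  have "ln (4 / \<omega>) = ln (4 * (1 / \<omega>))" by simp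
  also have "\<dots> = ln ((2::real) ^ 2) + ln (1 / \<omega>)" using w by (subst ln_mult) auto
  also have "\<dots> = ln 2 * (2 + log 2 (1 / \<omega>))"
    unfolding ln_realpow using ln2 by (simp add: log_def algebra_simps)
  also have "\<dots> \<le> ln 2 * (3 * l)" using ln2 l by (intro mult_left_mono) auto
  also have "\<dots> \<le> 1 * (3 * l)" using ln2 l by (intro mult_right_mono) auto
  finally have ln: "ln (4 / \<omega>) \<le> 3 * l" by simp
  have t2: "t\<^sup>2 \<ge> 4/9" using power_mono[OF t, of 2] by (simp add: power2_eq_square)
  have t2l: "t\<^sup>2 * l \<ge> 4/9" using mult_mono[OF t2 l(1)] t2 by simp
  have "36 * t\<^sup>2 * ln (4 / \<omega>) \<le> 36 * t\<^sup>2 * (3 * l)" by (intro mult_left_mono ln) simp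
  then have "\<lceil>36 * t\<^sup>2 * ln (4 / \<omega>)\<rceil> \<le> 108 * (t\<^sup>2 * l) + 1" by linarith
  then have "real k \<le> 108 * (t\<^sup>2 * l) + 1"
    unfolding k_def using t2l by (cases "0 \<le> \<lceil>36 * t\<^sup>2 * ln (4 / \<omega>)\<rceil>") (simp, linarith)+
  \<comment> \<open>The additive 2 is absorbed because
    \<open>5 * (t\<^sup>2 * l) \<ge> 20/9\<close>.\<close>
  then have "real k + 1 \<le> 113 * (t\<^sup>2 * l)" using t2l by linarith
  then have "(real k + 1)\<^sup>2 \<le> (113 * (t\<^sup>2 * l))\<^sup>2" by (intro power_mono) auto
  also have "\<dots> = 12769 * (t ^ 4 * l\<^sup>2)" by (simp add: power_mult_distrib flip: power_mult)
  finally have "3 * (real k + 1)\<^sup>2 \<le> 38307 * (t ^ 4 * l\<^sup>2)" by linarith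
  also have "\<dots> \<le> 40000 * (t ^ 4 * l\<^sup>2)" by (intro mult_right_mono) auto
  finally show ?thesis by (simp add: l_def)
qed

theorem theorem1:
  shows "\<exists>C::real. \<forall>(n::nat) (\<epsilon>::real) (\<omega>::real). \<epsilon> > 0 \<longrightarrow> \<omega> > 0 \<longrightarrow>
    comm_complexity_le (boolean_functions n) (boolean_functions n)
      (\<lambda>f g. linear_iso_distance n f g \<le> \<epsilon>)
      (\<lambda>f g. linear_iso_distance n f g \<ge> \<epsilon> + \<omega>)
      (\<lambda>f g. let t = min (approx_spectral_norm n (1/3) f) (approx_spectral_norm n (1/3) g)
              in C * (t ^ 4 * (max 1 (log 2 (1 / \<omega>))) ^ 2))"
proof (intro exI[of _ 40000] allI impI)
  fix n :: nat and \<epsilon> \<omega> :: real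
  assume w: "\<omega> > 0"
  let ?X = "boolean_functions n"
  let ?t = "approx_spectral_norm n (1/3)"
  let ?near = "\<lambda>k f. \<exists>h\<in>canonical_majorities n k. linear_iso_distance n f h \<le> \<omega> / 4"
  let ?k = "\<lambda>t. nat \<lceil>36 * t\<^sup>2 * ln (4 / \<omega>)\<rceil>"
  obtain P where P: "solves_promise P ?X ?X
      (\<lambda>f g. linear_iso_distance n f g \<le> \<epsilon>) (\<lambda>f g. linear_iso_distance n f g \<ge> \<epsilon> + \<omega>)"
    and bits: "\<And>f g k. f \<in> ?X \<Longrightarrow> g \<in> ?X \<Longrightarrow> ?near k f \<or> ?near k g \<Longrightarrow>
      bits_exchanged P f g \<le> 3 * (k + 1)\<^sup>2"
    using isomorphism_protocol[OF w, of n \<epsilon>] by blast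
  have near: "?near (?k (?t f)) f" if "f \<in> ?X" for f
    by (rule near_canonical_majority[OF that w real_nat_ceiling_ge])
  have "real (bits_exchanged P f g)
      \<le> 40000 * (min (?t f) (?t g) ^ 4 * (max 1 (log 2 (1 / \<omega>))) ^ 2)"
    if f: "f \<in> ?X" and g: "g \<in> ?X" for f g
  proof -
    let ?m = "min (?t f) (?t g)"
    \<comment> \<open>The minimum is one of the two norms, so this parameter suits its owner.
      \<open>P\<close> was fixed before \<open>f\<close> and \<open>g\<close>, and the parameter
      enters only the cost analysis.\<close>
    have "?near (?k ?m) f \<or> ?near (?k ?m) g"
      using near[OF f] near[OF g] by (cases "?t f \<le> ?t g") (simp_all add: min_def)
    from bits[OF f g this] have "real (bits_exchanged P f g) \<le> real (3 * (?k ?m + 1)\<^sup>2)"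
      by (rule of_nat_mono)
    also have "\<dots> = 3 * (real (?k ?m) + 1)\<^sup>2" by simp
    also have "\<dots> \<le> 40000 * (?m ^ 4 * (max 1 (log 2 (1 / \<omega>))) ^ 2)"
      using approx_spectral_norm_ge[OF f] approx_spectral_norm_ge[OF g]
      by (intro sketch_size_le w) auto
    finally show ?thesis .
  qed
  with P show "comm_complexity_le ?X ?X
      (\<lambda>f g. linear_iso_distance n f g \<le> \<epsilon>)
      (\<lambda>f g. linear_iso_distance n f g \<ge> \<epsilon> + \<omega>)
      (\<lambda>f g. let t = min (?t f) (?t g) in 40000 * (t ^ 4 * (max 1 (log 2 (1 / \<omega>))) ^ 2))"
    unfolding comm_complexity_le_def Let_def by blast
qed

end
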